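(* Let $n$ and $k$ be positive integers with $n \geq 19k-2$. If $T$ is a tournament on $n$ vertices, then $\mathrm{sinv}'_k(T) \leq \mathrm{sinv}_k(T) \leq 1$.
   Context: A tournament is an orientation of a complete graph. For a digraph $D$ and $X \subseteq V(D)$, inverting $X$ means reversing the direction of every arc of $D$ with both endvertices in $X$. A digraph $D$ is $k$-arc-strong if for every partition $(V_1,V_2)$ of $V(D)$ into nonempty sets there are at least $k$ arcs from $V_1$ to $V_2$; it is $k$-strong if $|V(D)|\ge k+1$ and $D-S$ is strongly connected for every $S\subseteq V(D)$ with $|S|<k$. $\mathrm{sinv}'_k(D)$ (resp. $\mathrm{sinv}_k(D)$) is the minimum number of sets whose successive inversion transforms $D$ into a $k$-arc-strong (resp. $k$-strong) digraph. *)

theory Defs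
  imports Main "HOL-Library.Extended_Nat"
begin

(* A digraph is a pair (V, A): a finite vertex set V and an arc relation A \<subseteq> V \<times> V
   without loops. *)

definition digraph :: "'a set \<Rightarrow> ('a \<times> 'a) set \<Rightarrow> bool" where
  "digraph V A \<longleftrightarrow> finite V \<and> A \<subseteq> V \<times> V \<and> (\<forall>v. (v, v) \<notin> A)"

definition tournament :: "'a set \<Rightarrow> ('a \<times> 'a) set \<Rightarrow> bool" where
  "tournament V A \<longleftrightarrow> digraph V A \<and>
     (\<forall>u\<in>V. \<forall>v\<in>V. u \<noteq> v \<longrightarrow> ((u, v) \<in> A \<longleftrightarrow> (v, u) \<notin> A))"

(* Inverting X: reverse every arc with both endvertices in X. *)
definition invert :: "('a \<times> 'a) set \<Rightarrow> 'a set \<Rightarrow> ('a \<times> 'a) set" where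
  "invert A X = {(u, v). (u, v) \<in> A \<and> \<not> (u \<in> X \<and> v \<in> X)}
              \<union> {(v, u) | u v. (u, v) \<in> A \<and> u \<in> X \<and> v \<in> X}"

(* Successive inversion of a list of sets X_1, ..., X_m (first X_1). *)
definition invert_seq :: "('a \<times> 'a) set \<Rightarrow> 'a set list \<Rightarrow> ('a \<times> 'a) set" where
  "invert_seq A Xs = fold (\<lambda>X B. invert B X) Xs A"

definition arc_strong :: "nat \<Rightarrow> 'a set \<Rightarrow> ('a \<times> 'a) set \<Rightarrow> bool" where
  "arc_strong k V A \<longleftrightarrow>
     (\<forall>V1 V2. V1 \<noteq> {} \<and> V2 \<noteq> {} \<and> V1 \<inter> V2 = {} \<and> V1 \<union> V2 = V \<longrightarrow>
        card {(u, v). (u, v) \<in> A \<and> u \<in> V1 \<and> v \<in> V2} \<ge> k)"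

definition strongly_connected :: "'a set \<Rightarrow> ('a \<times> 'a) set \<Rightarrow> bool" where
  "strongly_connected W A \<longleftrightarrow> (\<forall>u\<in>W. \<forall>v\<in>W. (u, v) \<in> (A \<inter> (W \<times> W))\<^sup>*)"

definition vertex_strong :: "nat \<Rightarrow> 'a set \<Rightarrow> ('a \<times> 'a) set \<Rightarrow> bool" where
  "vertex_strong k V A \<longleftrightarrow> card V \<ge> k + 1 \<and>
     (\<forall>S. S \<subseteq> V \<and> card S < k \<longrightarrow> strongly_connected (V - S) A)"

(* sinv'_k and sinv_k; value \<infinity> if no sequence of inversions works. *)
definition sinv_arc :: "nat \<Rightarrow> 'a set \<Rightarrow> ('a \<times> 'a) set \<Rightarrow> enat" where
  "sinv_arc k V A = (INF Xs \<in> {Xs. set Xs \<subseteq> Pow V \<and> arc_strong k V (invert_seq A Xs)}.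
                        enat (length Xs))"

definition sinv :: "nat \<Rightarrow> 'a set \<Rightarrow> ('a \<times> 'a) set \<Rightarrow> enat" where
  "sinv k V A = (INF Xs \<in> {Xs. set Xs \<subseteq> Pow V \<and> vertex_strong k V (invert_seq A Xs)}.
                    enat (length Xs))"

end

theory Submission
  imports Defs
begin

text \<open>It is enough to find a core: a set \<open>C\<close> with \<open>X \<subseteq> C\<close> such that both \<open>X\<close> and \<open>C - X\<close> have at least
  \<open>2k - 1\<close> vertices and inverting \<open>X\<close> makes \<open>C\<close> \<open>k\<close>-strong, since every further vertex can then be attached
  by deciding whether it is inverted as well. Set \<open>2k - 1\<close> vertices \<open>U\<close> aside and repeatedly move
  vertices with fewer than \<open>k\<close> in-neighbours (out-neighbours) in the rest \<open>C\<close> to a set \<open>L\<close> (\<open>H\<close>). If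
  this stops early, \<open>C \<union> U\<close> is a core with \<open>X = U\<close>, or a separator of \<open>C\<close> leaves two large sides, one
  dominating the other. If \<open>L\<close> becomes large, it dominates most of \<open>C\<close> in an approximate sense. In
  these domination cases \<open>P \<Rightarrow> Q\<close>, a core is obtained by inverting \<open>P\<close> together with the end of a median
  order of \<open>Q\<close>. The case of large \<open>H\<close> follows by reversing all arcs.\<close>

section \<open>Vertex-connectivity versus arc-connectivity\<close>

lemma exists_notin_small:
  assumes "finite S" "card S < k" "k \<le> card Z"
  obtains z where "z \<in> Z" "z \<notin> S"
proof -
  have "\<not> Z \<subseteq> S" using card_mono[OF assms(1), of Z] assms(2,3) by linarith
  then show ?thesis using that by blast
qed

text \<open>A cut with fewer than \<open>k\<close> arcs is destroyed by deleting one endvertex of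
  each arc, provided a vertex survives on either side. This can be arranged unless every pair across
  the cut is an arc, and then there are too many arcs.\<close>

lemma vertex_strong_imp_arc_strong:
  assumes fin: "finite V" and vs: "vertex_strong k V A"
  shows "arc_strong k V A"
  unfolding arc_strong_def
proof (intro allI impI)
  fix V1 V2 assume asm: "V1 \<noteq> {} \<and> V2 \<noteq> {} \<and> V1 \<inter> V2 = {} \<and> V1 \<union> V2 = V"
  define F where "F = {(u, v). (u, v) \<in> A \<and> u \<in> V1 \<and> v \<in> V2}"
  have fin12: "finite V1" "finite V2" using asm fin by auto
  have F_sub: "F \<subseteq> V1 \<times> V2" by (auto simp: F_def)
  then have finF: "finite F" using fin12 finite_subset by blast
  have "k \<le> card F"
  proof (rule ccontr)
    assume "\<not> k \<le> card F"
    then have Fk: "card F < k" by simp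
    show False
    proof (cases "F = V1 \<times> V2")
      case True
      have "card V1 \<ge> 1" "card V2 \<ge> 1"
        using asm fin12 by (auto simp: Suc_le_eq card_gt_0_iff)
      then obtain p q where pq: "card V1 = Suc p" "card V2 = Suc q"
        by (metis One_nat_def Suc_le_D)
      have "card V = card V1 + card V2" using asm fin12 card_Un_disjoint by blast
      moreover have "k + 1 \<le> card V" using vs by (simp add: vertex_strong_def)
      moreover have "card F = card V1 * card V2" using True by (simp add: card_cartesian_product)
      \<comment> \<open>With both sides nonempty,
        \<open>(p + 1) * (q + 1) \<ge> p + q + 1 = card V - 1 \<ge> k\<close>.\<close>
      ultimately show False using Fk pq by simp
    next
      case False
      then obtain u v where uv: "u \<in> V1" "v \<in> V2" "(u, v) \<notin> F" using F_sub by auto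
      \<comment> \<open>The tail of each arc is deleted unless it is \<open>u\<close>, and then the
        head is. That head is not \<open>v\<close>, because \<open>(u, v)\<close> is not in
        \<open>F\<close>; so both \<open>u\<close> and \<open>v\<close> survive.\<close>
      define S where "S = (\<lambda>(a, b). if a \<noteq> u then a else b) ` F"
      have S: "S \<subseteq> V" "u \<notin> S" "v \<notin> S"
        using F_sub asm uv by (auto simp: S_def split: if_splits)
      have "card S < k" using card_image_le[OF finF] Fk unfolding S_def by (meson le_less_trans)
      then have "strongly_connected (V - S) A"
        using vs S(1) by (simp add: vertex_strong_def)
      moreover have "u \<in> V - S" "v \<in> V - S" using uv S asm by auto
      ultimately have "(u, v) \<in> (A \<inter> (V - S) \<times> (V - S))\<^sup>*"
        by (simp add: strongly_connected_def)
      then have "v \<in> V1"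
      proof (induction rule: rtrancl_induct)
        case base then show ?case by (rule uv(1))
      next
        case (step y z)
        show ?case
        proof (rule ccontr)
          assume "z \<notin> V1"
          then have "(y, z) \<in> F" using step asm by (auto simp: F_def)
          then have "(if y \<noteq> u then y else z) \<in> S" unfolding S_def by force
          then show False using step by (auto split: if_splits)
        qed
      qed
      then show False using uv asm by auto
    qed
  qed
  then show "k \<le> card {(u, v). (u, v) \<in> A \<and> u \<in> V1 \<and> v \<in> V2}" by (simp add: F_def)
qed

section \<open>Inversion, arc reversal and degrees in tournaments\<close>

lemma mem_invert_iff:
  "(u, v) \<in> invert A X \<longleftrightarrow> (if u \<in> X \<and> v \<in> X then (v, u) \<in> A else (u, v) \<in> A)"
  by (auto simp: invert_def)

lemma invert_converse: "invert (A\<inverse>) X = (invert A X)\<inverse>"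
  by (auto simp: mem_invert_iff split: if_splits)

lemma strongly_connected_converse: "strongly_connected W (A\<inverse>) \<longleftrightarrow> strongly_connected W A"
proof -
  have "A\<inverse> \<inter> W \<times> W = (A \<inter> W \<times> W)\<inverse>" by auto
  then show ?thesis by (auto simp: strongly_connected_def rtrancl_converse)
qed

lemma strongly_connected_extend:
  assumes sc: "strongly_connected W R" and sub: "W \<subseteq> W'"
    and out: "\<And>v. v \<in> W' - W \<Longrightarrow> \<exists>w\<in>W. (v, w) \<in> R"
    and inn: "\<And>v. v \<in> W' - W \<Longrightarrow> \<exists>w\<in>W. (w, v) \<in> R"
  shows "strongly_connected W' R"
  unfolding strongly_connected_def
proof (intro ballI)
  let ?E = "R \<inter> W' \<times> W'"
  fix u v assume uv: "u \<in> W'" "v \<in> W'"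
  have E: "(R \<inter> W \<times> W)\<^sup>* \<subseteq> ?E\<^sup>*" using sub by (intro rtrancl_mono) auto
  have "\<exists>w\<in>W. (u, w) \<in> ?E\<^sup>*" using out[of u] uv sub by (cases "u \<in> W") blast+
  moreover have "\<exists>w\<in>W. (w, v) \<in> ?E\<^sup>*" using inn[of v] uv sub by (cases "v \<in> W") blast+
  ultimately show "(u, v) \<in> ?E\<^sup>*"
    using sc E unfolding strongly_connected_def by (meson rtrancl_trans subsetD)
qed

text \<open>\<open>Q\<close> is everything reachable from a vertex \<open>u\<close> that fails to
  reach some \<open>v\<close>, so no arc leaves \<open>Q\<close>.\<close>

lemma not_strongly_connectedE:
  assumes "\<not> strongly_connected W A"
  obtains P Q where "P \<noteq> {}" "Q \<noteq> {}" "P \<inter> Q = {}" "P \<union> Q = W"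
    "\<forall>p\<in>P. \<forall>q\<in>Q. (q, p) \<notin> A"
proof -
  let ?E = "A \<inter> W \<times> W"
  from assms obtain u v where uv: "u \<in> W" "v \<in> W" "(u, v) \<notin> ?E\<^sup>*"
    by (auto simp: strongly_connected_def)
  define Q where "Q = {x \<in> W. (u, x) \<in> ?E\<^sup>*}"
  show ?thesis
  proof (rule that[of "W - Q" Q])
    show "\<forall>p\<in>W - Q. \<forall>q\<in>Q. (q, p) \<notin> A"
      unfolding Q_def by (auto intro: rtrancl_into_rtrancl)
  qed (use uv in \<open>auto simp: Q_def\<close>)
qed

lemma tournament_arc_iff:
  "tournament V A \<Longrightarrow> u \<in> V \<Longrightarrow> v \<in> V \<Longrightarrow> u \<noteq> v \<Longrightarrow> (u, v) \<in> A \<longleftrightarrow> (v, u) \<notin> A"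
  unfolding tournament_def by blast

lemma tournament_finite: "tournament V A \<Longrightarrow> finite V"
  by (simp add: tournament_def digraph_def)

lemma tournament_converse: "tournament V A \<Longrightarrow> tournament V (A\<inverse>)"
  unfolding tournament_def digraph_def by blast

lemma tournament_card_out_in:
  assumes T: "tournament V A" and D: "D \<subseteq> V" and v: "v \<in> V" "v \<notin> D"
  shows "card {w \<in> D. (v, w) \<in> A} + card {w \<in> D. (w, v) \<in> A} = card D"
proof -
  have fin: "finite D" using D tournament_finite[OF T] finite_subset by blast
  have "{w \<in> D. (w, v) \<in> A} = D - {w \<in> D. (v, w) \<in> A}"
    using tournament_arc_iff[OF T, of _ v] D v by blast
  moreover have "card {w \<in> D. (v, w) \<in> A} \<le> card D" using fin by (simp add: card_mono)
  ultimately show ?thesis using fin by (simp add: card_Diff_subset)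
qed

section \<open>Extending a strong core to the whole tournament\<close>

definition invertible_to_strong :: "nat \<Rightarrow> 'a set \<Rightarrow> ('a \<times> 'a) set \<Rightarrow> bool" where
  "invertible_to_strong k V A \<longleftrightarrow> (\<exists>X\<subseteq>V. vertex_strong k V (invert A X))"

lemma invertible_to_strong_converse:
  "invertible_to_strong k V (A\<inverse>) \<longleftrightarrow> invertible_to_strong k V A"
  by (simp add: invertible_to_strong_def vertex_strong_def invert_converse strongly_connected_converse)

text \<open>A vertex outside a \<open>k\<close>-strong core may join the inverted set or not. Since it has \<open>k\<close> in- or
  \<open>k\<close> out-neighbours both among the inverted and among the other core vertices, one of the two
  choices gives it \<open>k\<close> in- and \<open>k\<close> out-neighbours in the core.\<close>
lemma invertible_to_strong_if_core:
  assumes T: "tournament V A" and k: "k \<ge> 1" and C: "C \<subseteq> V" and X0: "X0 \<subseteq> C"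
    and cX: "2 * k - 1 \<le> card X0" and cW: "2 * k - 1 \<le> card (C - X0)"
    and sc: "\<And>S. finite S \<Longrightarrow> card S < k \<Longrightarrow> strongly_connected (C - S) (invert A X0)"
  shows "invertible_to_strong k V A"
proof -
  have finV: "finite V" using T by (rule tournament_finite)
  have finC: "finite C" using C finV finite_subset by blast
  define good where "good v \<longleftrightarrow> k \<le> card {w \<in> C. (v, w) \<in> A} \<and> k \<le> card {w \<in> C. (w, v) \<in> A}" for v
  define X where "X = X0 \<union> {v \<in> V - C. \<not> good v}"
  let ?R = "invert A X"
  have attach: "k \<le> card {w \<in> C. (v, w) \<in> ?R} \<and> k \<le> card {w \<in> C. (w, v) \<in> ?R}"
    if v: "v \<in> V - C" for v
  proof (cases "good v")
    case True
    then have "v \<notin> X" using v X0 by (auto simp: X_def)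
    then show ?thesis using True by (simp add: good_def mem_invert_iff)
  next
    case False
    then have vX: "v \<in> X" using v by (simp add: X_def)
    have mX: "w \<in> X \<longleftrightarrow> w \<in> X0" if "w \<in> C" for w using that by (auto simp: X_def)
    let ?o = "\<lambda>D. {w \<in> D. (v, w) \<in> A}" and ?i = "\<lambda>D. {w \<in> D. (w, v) \<in> A}"
    have fin: "finite X0" "finite (C - X0)" using finC X0 finite_subset by blast+
    have split: "card {w \<in> C. Pr w} = card {w \<in> X0. Pr w} + card {w \<in> C - X0. Pr w}" for Pr
    proof -
      have "{w \<in> C. Pr w} = {w \<in> X0. Pr w} \<union> {w \<in> C - X0. Pr w}" using X0 by auto
      then show ?thesis using fin by (simp add: card_Un_disjoint disjoint_iff)
    qed
    have sums: "card (?o X0) + card (?i X0) = card X0"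
      "card (?o (C - X0)) + card (?i (C - X0)) = card (C - X0)"
      by (rule tournament_card_out_in[OF T]; use v C X0 in auto)+
    have oC: "card (?o C) = card (?o X0) + card (?o (C - X0))"
      and iC: "card (?i C) = card (?i X0) + card (?i (C - X0))"
      by (rule split)+
    have "{w \<in> C. (v, w) \<in> ?R} = ?i X0 \<union> ?o (C - X0)"
      "{w \<in> C. (w, v) \<in> ?R} = ?o X0 \<union> ?i (C - X0)"
      using vX mX X0 by (auto simp: mem_invert_iff)
    then have R: "card {w \<in> C. (v, w) \<in> ?R} = card (?i X0) + card (?o (C - X0))"
      "card {w \<in> C. (w, v) \<in> ?R} = card (?o X0) + card (?i (C - X0))"
      using fin by (simp_all add: card_Un_disjoint disjoint_iff)
    have "\<not> (k \<le> card (?o C) \<and> k \<le> card (?i C))" using False by (simp add: good_def)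
    then show ?thesis unfolding R using sums oC iC cX cW k by linarith
  qed
  have "strongly_connected (V - S) ?R" if S: "S \<subseteq> V" "card S < k" for S
  proof (rule strongly_connected_extend)
    have finS: "finite S" using S finV finite_subset by blast
    \<comment> \<open>The vertices added to \<open>X0\<close> lie outside \<open>C\<close>, so
      inside \<open>C\<close> the two inversions agree.\<close>
    have "invert A X0 \<inter> (C - S) \<times> (C - S) = ?R \<inter> (C - S) \<times> (C - S)"
      by (auto simp: mem_invert_iff X_def split: if_splits)
    then show "strongly_connected (C - S) ?R"
      using sc[OF finS S(2)] by (simp add: strongly_connected_def)
    show "C - S \<subseteq> V - S" using C by auto
    fix v assume "v \<in> V - S - (C - S)"
    then have v: "v \<in> V - C" by auto
    show "\<exists>w\<in>C - S. (v, w) \<in> ?R"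
      by (rule exists_notin_small[OF finS S(2) conjunct1[OF attach[OF v]]]) auto
    show "\<exists>w\<in>C - S. (w, v) \<in> ?R"
      by (rule exists_notin_small[OF finS S(2) conjunct2[OF attach[OF v]]]) auto
  qed
  moreover have "k + 1 \<le> card V"
  proof -
    have "card C = card X0 + card (C - X0)"
      using X0 finC by (metis card_Un_disjoint Diff_disjoint Diff_partition finite_Diff finite_subset)
    moreover have "card C \<le> card V" using C finV by (rule card_mono[rotated])
    ultimately show ?thesis using cX cW k by linarith
  qed
  moreover have "X \<subseteq> V" using C X0 by (auto simp: X_def)
  ultimately show ?thesis by (auto simp: invertible_to_strong_def vertex_strong_def)
qed

section \<open>Median orders\<close>

definition arcs_between :: "('a \<times> 'a) set \<Rightarrow> 'a list \<Rightarrow> 'a list \<Rightarrow> nat" where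
  "arcs_between A xs ys = (\<Sum>x\<leftarrow>xs. length (filter (\<lambda>y. (x, y) \<in> A) ys))"

fun forward_arcs :: "('a \<times> 'a) set \<Rightarrow> 'a list \<Rightarrow> nat" where
  "forward_arcs A [] = 0"
| "forward_arcs A (x # xs) = arcs_between A [x] xs + forward_arcs A xs"

lemma arcs_between_append:
  "arcs_between A (xs @ ys) zs = arcs_between A xs zs + arcs_between A ys zs"
  "arcs_between A xs (ys @ zs) = arcs_between A xs ys + arcs_between A xs zs"
  by (simp_all add: arcs_between_def sum_list_addf)

text \<open>Counting over lists makes this hold without distinctness. When two orders differ by
  moving a vertex across a window, expanding both leaves only the arcs between that vertex and the
  window uncancelled.\<close>

lemma forward_arcs_append:
  "forward_arcs A (xs @ ys) = forward_arcs A xs + forward_arcs A ys + arcs_between A xs ys"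
proof (induction xs)
  case Nil
  then show ?case by (simp add: arcs_between_def)
next
  case (Cons x xs)
  have "arcs_between A (x # xs) ys = arcs_between A [x] ys + arcs_between A xs ys"
    by (simp add: arcs_between_def)
  then show ?case using Cons by (simp add: arcs_between_append)
qed

lemma arcs_between_singleton_left:
  "distinct ws \<Longrightarrow> arcs_between A [v] ws = card {w \<in> set ws. (v, w) \<in> A}"
  by (simp add: arcs_between_def distinct_length_filter Int_def conj_commute)

lemma arcs_between_singleton_right:
  "distinct ws \<Longrightarrow> arcs_between A ws [v] = card {w \<in> set ws. (w, v) \<in> A}"
proof (induction ws)
  case Nil
  then show ?case by (simp add: arcs_between_def)
next
  case (Cons x ws)
  have "{w \<in> set (x # ws). (w, v) \<in> A} =
      (if (x, v) \<in> A then insert x {w \<in> set ws. (w, v) \<in> A} else {w \<in> set ws. (w, v) \<in> A})"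
    by auto
  then show ?case using Cons by (simp add: arcs_between_def)
qed

text \<open>Encoded by the local window property instead of the maximality of
  \<open>forward_arcs\<close>: at least half of any window directly after (before) a vertex consists
  of its out-neighbours (in-neighbours).\<close>

definition median_order :: "('a \<times> 'a) set \<Rightarrow> 'a list \<Rightarrow> bool" where
  "median_order A xs \<longleftrightarrow>
     (\<forall>ys v ws zs. xs = ys @ [v] @ ws @ zs \<longrightarrow> length ws \<le> 2 * card {w \<in> set ws. (v, w) \<in> A}) \<and>
     (\<forall>ys v ws zs. xs = ys @ ws @ [v] @ zs \<longrightarrow> length ws \<le> 2 * card {w \<in> set ws. (w, v) \<in> A})"

text \<open>The window inequalities hold in an order with the maximum number of forward arcs, because moving
  one vertex across a window does not increase that number.\<close>
lemma median_order_exists: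
  assumes T: "tournament V A" and D: "D \<subseteq> V"
  obtains xs where "distinct xs" "set xs = D" "median_order A xs"
proof -
  have finD: "finite D" using D tournament_finite[OF T] finite_subset by blast
  let ?Z = "{xs. distinct xs \<and> set xs = D}"
  have finZ: "finite ?Z"
    by (rule finite_subset[OF _ finite_subset_distinct[OF finD]]) auto
  have neZ: "?Z \<noteq> {}" using finite_distinct_list[OF finD] by auto
  define m where "m = Max (forward_arcs A ` ?Z)"
  have "m \<in> forward_arcs A ` ?Z" unfolding m_def using finZ neZ by (intro Max_in) auto
  then obtain xs where xs: "distinct xs" "set xs = D" "forward_arcs A xs = m" by auto
  have opt: "forward_arcs A xs' \<le> m" if "distinct xs'" "set xs' = D" for xs'
    unfolding m_def using finZ that by (intro Max_ge) auto
  have total: "card {w \<in> set ws. (v, w) \<in> A} + card {w \<in> set ws. (w, v) \<in> A} = length ws"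
    if "distinct (v # ws)" "set (v # ws) \<subseteq> D" for v ws
    using tournament_card_out_in[OF T, of "set ws" v] that D by (auto simp: distinct_card)
  have "median_order A xs"
    unfolding median_order_def
  proof (intro conjI allI impI)
    fix ys v ws zs assume eq: "xs = ys @ [v] @ ws @ zs"
    have d: "distinct (v # ws)" "set (v # ws) \<subseteq> D" using xs eq by auto
    have "forward_arcs A (ys @ ws @ [v] @ zs) \<le> forward_arcs A (ys @ [v] @ ws @ zs)"
      using xs eq opt[of "ys @ ws @ [v] @ zs"] by auto
    then have "arcs_between A ws [v] \<le> arcs_between A [v] ws"
      by (simp only: forward_arcs_append arcs_between_append)
    then show "length ws \<le> 2 * card {w \<in> set ws. (v, w) \<in> A}"
      using total[OF d] d(1) by (simp add: arcs_between_singleton_left arcs_between_singleton_right)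
  next
    fix ys v ws zs assume eq: "xs = ys @ ws @ [v] @ zs"
    have d: "distinct (v # ws)" "set (v # ws) \<subseteq> D" using xs eq by auto
    have "forward_arcs A (ys @ [v] @ ws @ zs) \<le> forward_arcs A (ys @ ws @ [v] @ zs)"
      using xs eq opt[of "ys @ [v] @ ws @ zs"] by auto
    then have "arcs_between A [v] ws \<le> arcs_between A ws [v]"
      by (simp only: forward_arcs_append arcs_between_append)
    then show "length ws \<le> 2 * card {w \<in> set ws. (w, v) \<in> A}"
      using total[OF d] d(1) by (simp add: arcs_between_singleton_left arcs_between_singleton_right)
  qed
  then show ?thesis using that xs(1,2) by blast
qed

section \<open>Tournaments in which one set dominates another\<close>

text \<open>The last \<open>2k - 1\<close> vertices of a median order of \<open>D\<close> form \<open>B\<close>, the others \<open>M\<close>. After inverting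
  \<open>N \<union> B\<close>, every vertex of \<open>M\<close> reaches \<open>B\<close> along the order, and any \<open>b \<in> B\<close> reaches any \<open>m \<in> M\<close> through
  a common in-neighbour in \<open>N\<close> (with respect to \<open>A\<close>), of which there are at least \<open>k\<close>.\<close>
lemma invertible_to_strong_if_dominating:
  assumes T: "tournament V A" and k: "k \<ge> 1" and N: "N \<subseteq> V" and D: "D \<subseteq> V"
    and disj: "N \<inter> D = {}" and cD: "6 * k - 3 \<le> card D"
    and low: "\<And>a. a \<in> N \<Longrightarrow> card {d \<in> D. (d, a) \<in> A} < k"
    and dom: "\<And>d. d \<in> D \<Longrightarrow> card N + k \<le> 2 * card {a \<in> N. (a, d) \<in> A}"
  shows "invertible_to_strong k V A"
proof -
  have finN: "finite N" and finD: "finite D"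
    using N D tournament_finite[OF T] finite_subset by blast+
  obtain xs where xs: "distinct xs" "set xs = D" and med: "median_order A xs"
    by (rule median_order_exists[OF T D])
  have after: "length ws \<le> 2 * card {w \<in> set ws. (v, w) \<in> A}" if "xs = ys @ [v] @ ws @ zs" for ys v ws zs
    using med that unfolding median_order_def by blast
  have before: "length ws \<le> 2 * card {w \<in> set ws. (w, v) \<in> A}" if "xs = ys @ ws @ [v] @ zs" for ys v ws zs
    using med that unfolding median_order_def by blast
  define r where "r = length xs - (2 * k - 1)"
  define ms where "ms = take r xs"
  define bs where "bs = drop r xs"
  define M where "M = set ms"
  define B where "B = set bs"
  have len: "length xs = card D" using xs distinct_card by fastforce
  have lr: "length xs = r + (2 * k - 1)" "4 * k - 2 \<le> r" using len cD k by (simp_all add: r_def)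
  have lms: "length ms = r" and lbs: "length bs = 2 * k - 1" using lr by (simp_all add: ms_def bs_def)
  have xs_eq: "xs = ms @ bs" by (simp add: ms_def bs_def)
  have dist: "distinct ms" "distinct bs" using xs by (simp_all add: ms_def bs_def)
  have MB: "M \<union> B = D" "M \<inter> B = {}" using xs xs_eq by (auto simp: M_def B_def)
  have cM: "card M = r" and cB: "card B = 2 * k - 1"
    using dist lms lbs by (simp_all add: M_def B_def distinct_card)
  have finB: "finite B" by (simp add: B_def)
  \<comment> \<open>The window is everything before \<open>b\<close>, with
    \<open>r + length b1\<close> vertices. Half of it are in-neighbours, and at most
    \<open>length b1 \<le> 2 * k - 2\<close> of these lie in \<open>B\<close>; since
    \<open>r \<ge> 4 * k - 2\<close>, at least \<open>k\<close> lie in \<open>M\<close>.\<close>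
  have in_M: "k \<le> card {m \<in> M. (m, b) \<in> A}" if b: "b \<in> B" for b
  proof -
    obtain b1 b2 where b12: "bs = b1 @ b # b2" using b split_list unfolding B_def by metis
    have "length (ms @ b1) \<le> 2 * card {w \<in> set (ms @ b1). (w, b) \<in> A}"
      by (rule before[of "[]" _ _ b2]) (simp add: xs_eq b12)
    also have "{w \<in> set (ms @ b1). (w, b) \<in> A} = {m \<in> M. (m, b) \<in> A} \<union> {w \<in> set b1. (w, b) \<in> A}"
      by (auto simp: M_def)
    also have "card \<dots> \<le> card {m \<in> M. (m, b) \<in> A} + card {w \<in> set b1. (w, b) \<in> A}"
      by (rule card_Un_le)
    also have "card {w \<in> set b1. (w, b) \<in> A} \<le> length b1"
      by (rule order_trans[OF card_mono card_length]) auto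
    finally have "length ms \<le> 2 * card {m \<in> M. (m, b) \<in> A} + length b1" by simp
    moreover have "length b1 \<le> 2 * k - 2" using b12 lbs by simp
    ultimately show ?thesis using lms lr(2) k by linarith
  qed
  \<comment> \<open>A window of \<open>2 * k - 1\<close> vertices contains at least \<open>k\<close>
    out-neighbours, half rounded up. It fits after every position below \<open>r\<close> because
    \<open>B\<close> has exactly this length.\<close>
  have out_window: "\<exists>W\<subseteq>set (drop (Suc i) xs). k \<le> card {w \<in> W. (xs ! i, w) \<in> A}" if i: "i < r" for i
  proof -
    define ws where "ws = take (2 * k - 1) (drop (Suc i) xs)"
    have "xs = take i xs @ [xs ! i] @ ws @ drop (2 * k - 1) (drop (Suc i) xs)"
      unfolding ws_def append_take_drop_id using i lr(1) by (simp add: id_take_nth_drop[symmetric])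
    then have "length ws \<le> 2 * card {w \<in> set ws. (xs ! i, w) \<in> A}" by (rule after)
    moreover have "length ws = 2 * k - 1" using i lr(1) by (simp add: ws_def)
    ultimately have "k \<le> card {w \<in> set ws. (xs ! i, w) \<in> A}" using k by linarith
    moreover have "set ws \<subseteq> set (drop (Suc i) xs)" unfolding ws_def by (rule set_take_subset)
    ultimately show ?thesis by (intro exI[of _ "set ws"] conjI)
  qed
  define C where "C = N \<union> D"
  define X where "X = N \<union> B"
  define R where "R = invert A X"
  have CX: "C - X = M" using MB disj by (auto simp: C_def X_def)
  show ?thesis
  proof (rule invertible_to_strong_if_core[OF T k, of C X])
    show "C \<subseteq> V" using N D by (simp add: C_def)
    show "X \<subseteq> C" using MB by (auto simp: C_def X_def)
    show "2 * k - 1 \<le> card X" using cB card_mono[of X B] finN finB by (simp add: X_def)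
    show "2 * k - 1 \<le> card (C - X)" using CX cM lr k by simp
    fix S :: "'a set" assume S: "finite S" "card S < k"
    let ?E = "R \<inter> (C - S) \<times> (C - S)"
    have MX: "m \<notin> X" if "m \<in> M" for m using that CX by auto
    have sub: "M \<subseteq> C" "B \<subseteq> C" "N \<subseteq> C" using MB by (auto simp: C_def)
    \<comment> \<open>Each vertex of \<open>M\<close> has a surviving out-neighbour later in the
      order, so jumping forward eventually enters \<open>B\<close>. Arcs leaving \<open>M\<close>
      are not reversed.\<close>
    have M_reaches: "\<exists>b\<in>B - S. (xs ! i, b) \<in> ?E\<^sup>*" if "i < r" "xs ! i \<notin> S" for i
      using that
    proof (induction "r - i" arbitrary: i rule: less_induct)
      case less
      obtain W where W: "W \<subseteq> set (drop (Suc i) xs)" "k \<le> card {w \<in> W. (xs ! i, w) \<in> A}"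
        using out_window less.prems by blast
      obtain w where w: "w \<in> W" "(xs ! i, w) \<in> A" "w \<notin> S"
        using exists_notin_small[OF S W(2)] by blast
      have "w \<in> set (drop (Suc i) xs)" using w(1) W(1) by auto
      then obtain l where "l < length xs - Suc i" "w = drop (Suc i) xs ! l"
        by (auto simp: in_set_conv_nth)
      then obtain j where j: "i < j" "j < length xs" "w = xs ! j"
        by (intro that[of "Suc i + l"]) auto
      have "xs ! i = ms ! i" using less.prems by (simp add: ms_def)
      then have iM: "xs ! i \<in> M" using less.prems lms by (simp add: M_def)
      have "w \<in> D" using j xs(2) by auto
      then have E: "(xs ! i, w) \<in> ?E"
        using iM MX w less.prems sub MB by (auto simp: R_def mem_invert_iff)
      show ?case
      proof (cases "j < r")
        case True
        then have "\<exists>b\<in>B - S. (xs ! j, b) \<in> ?E\<^sup>*" using less.hyps[of j] j w by simp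
        then show ?thesis using E j(3) by (meson converse_rtrancl_into_rtrancl)
      next
        case False
        have "bs ! (j - r) = w" "j - r < length bs" using False j lr by (simp_all add: bs_def)
        then have "w \<in> B" unfolding B_def by (metis nth_mem)
        then show ?thesis using E w by blast
      qed
    qed
    have M_to_B: "\<exists>b\<in>B - S. (m, b) \<in> ?E\<^sup>*" if m: "m \<in> M - S" for m
    proof -
      obtain i where "i < length ms" "m = ms ! i" using m by (auto simp: M_def in_set_conv_nth)
      then have "i < r" "m = xs ! i" using lms by (simp_all add: ms_def)
      then show ?thesis using M_reaches m by blast
    qed
    have B_from_M: "\<exists>m\<in>M - S. (m, b) \<in> ?E" if b: "b \<in> B - S" for b
    proof -
      obtain m where "m \<in> M" "(m, b) \<in> A" "m \<notin> S"
        using exists_notin_small[OF S in_M] b by blast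
      then show ?thesis using b MX sub by (auto simp: R_def mem_invert_iff)
    qed
    have B_to_M: "(b, m) \<in> ?E\<^sup>*" if b: "b \<in> B - S" and m: "m \<in> M - S" for b m
    proof -
      let ?n = "\<lambda>d. {a \<in> N. (a, d) \<in> A}"
      have "card (?n b \<union> ?n m) \<le> card N" by (rule card_mono[OF finN]) auto
      moreover have "card (?n b) + card (?n m) = card (?n b \<union> ?n m) + card (?n b \<inter> ?n m)"
        using finN by (intro card_Un_Int) auto
      moreover have "card N + k \<le> 2 * card (?n b)" "card N + k \<le> 2 * card (?n m)"
        using dom b m MB by blast+
      ultimately have "k \<le> card (?n b \<inter> ?n m)" by linarith
      then obtain a where "a \<in> N" "(a, b) \<in> A" "(a, m) \<in> A" "a \<notin> S"
        using exists_notin_small[OF S] by blast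
      then have "(b, a) \<in> ?E" "(a, m) \<in> ?E"
        using b m MX sub by (auto simp: R_def mem_invert_iff X_def)
      then show ?thesis by (meson r_into_rtrancl rtrancl_into_rtrancl)
    qed
    have D_conn: "(x, y) \<in> ?E\<^sup>*" if x: "x \<in> D - S" and y: "y \<in> D - S" for x y
    proof -
      obtain b where b: "b \<in> B - S" "(x, b) \<in> ?E\<^sup>*"
        using M_to_B[of x] x MB by (cases "x \<in> B") auto
      obtain m where m: "m \<in> M - S" "(m, y) \<in> ?E\<^sup>*"
        using B_from_M[of y] y MB by (cases "y \<in> M") blast+
      show ?thesis using b m B_to_M by (meson rtrancl_trans)
    qed
    \<comment> \<open>Applied to \<open>M\<close> and to \<open>B\<close>: out-neighbours in
      \<open>M\<close> remain out-neighbours after the inversion, while those in \<open>B\<close>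
      become in-neighbours. This attaches \<open>a\<close> to \<open>D\<close> in both
      directions.\<close>
    have N_nbr: "k \<le> card {d \<in> Z. (a, d) \<in> A}" if a: "a \<in> N" and Z: "Z \<subseteq> D" "2 * k - 1 \<le> card Z" for a Z
    proof -
      have "card {d \<in> Z. (a, d) \<in> A} + card {d \<in> Z. (d, a) \<in> A} = card Z"
        by (rule tournament_card_out_in[OF T]) (use a Z N D disj in auto)
      moreover have "card {d \<in> Z. (d, a) \<in> A} \<le> card {d \<in> D. (d, a) \<in> A}"
        by (rule card_mono) (use Z finD in auto)
      ultimately show ?thesis using low[OF a] Z(2) by linarith
    qed
    have N_out: "\<exists>d\<in>D - S. (a, d) \<in> ?E" if a: "a \<in> N - S" for a
    proof -
      have "k \<le> card {m \<in> M. (a, m) \<in> A}" by (rule N_nbr) (use a MB cM lr k in auto)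
      then obtain m where "m \<in> M" "(a, m) \<in> A" "m \<notin> S" using exists_notin_small[OF S] by blast
      then show ?thesis using a MX MB sub by (intro bexI[of _ m]) (auto simp: R_def mem_invert_iff)
    qed
    have N_in: "\<exists>d\<in>D - S. (d, a) \<in> ?E" if a: "a \<in> N - S" for a
    proof -
      have "k \<le> card {b \<in> B. (a, b) \<in> A}" by (rule N_nbr) (use a MB cB in auto)
      then obtain b where "b \<in> B" "(a, b) \<in> A" "b \<notin> S" using exists_notin_small[OF S] by blast
      then show ?thesis using a MB sub by (intro bexI[of _ b]) (auto simp: R_def mem_invert_iff X_def)
    qed
    have "(x, y) \<in> ?E\<^sup>*" if x: "x \<in> C - S" and y: "y \<in> C - S" for x y
    proof -
      obtain x' where x': "x' \<in> D - S" "(x, x') \<in> ?E\<^sup>*"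
        using N_out[of x] x by (cases "x \<in> D") (auto simp: C_def)
      obtain y' where y': "y' \<in> D - S" "(y', y) \<in> ?E\<^sup>*"
        using N_in[of y] y by (cases "y \<in> D") (auto simp: C_def)
      show ?thesis using D_conn x' y' by (meson rtrancl_trans)
    qed
    then show "strongly_connected (C - S) (invert A X)"
      by (simp add: strongly_connected_def R_def)
  qed
qed

section \<open>Approximate domination by double counting\<close>

lemma sum_card_swap:
  assumes "finite I" "finite J"
  shows "(\<Sum>i\<in>I. card {j \<in> J. Pr i j}) = (\<Sum>j\<in>J. card {i \<in> I. Pr i j})"
proof -
  have "(\<Sum>i\<in>I. card {j \<in> J. Pr i j}) = (\<Sum>i\<in>I. \<Sum>j\<in>J. if Pr i j then 1 else 0)"
    using assms by (simp add: sum.If_cases Int_def)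
  also have "\<dots> = (\<Sum>j\<in>J. \<Sum>i\<in>I. if Pr i j then 1 else 0)" by (rule sum.swap)
  also have "\<dots> = (\<Sum>j\<in>J. card {i \<in> I. Pr i j})"
    using assms by (simp add: sum.If_cases Int_def)
  finally show ?thesis .
qed

text \<open>Each vertex of \<open>L\<close> receives fewer than \<open>k\<close> arcs from
  \<open>C\<close>, whereas a vertex of \<open>C\<close> violating the domination condition sends
  more than \<open>(card L - k) / 2\<close> arcs to \<open>L\<close>. Hence fewer than
  \<open>4 * k\<close> vertices are bad, and \<open>L\<close> dominates the at least
  \<open>6 * k\<close> others.\<close>

lemma invertible_to_strong_if_many_low:
  assumes T: "tournament V A" and k: "k \<ge> 1" and L: "L \<subseteq> V" and C: "C \<subseteq> V"
    and disj: "L \<inter> C = {}" and cL: "2 * k \<le> card L" and cC: "10 * k \<le> card C"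
    and low: "\<And>a. a \<in> L \<Longrightarrow> card {c \<in> C. (c, a) \<in> A} < k"
  shows "invertible_to_strong k V A"
proof -
  have finL: "finite L" and finC: "finite C"
    using L C tournament_finite[OF T] finite_subset by blast+
  define Bad where "Bad = {c \<in> C. 2 * card {a \<in> L. (a, c) \<in> A} < card L + k}"
  have finB: "finite Bad" using finC by (simp add: Bad_def)
  have bad: "card L - k + 1 \<le> 2 * card {a \<in> L. (c, a) \<in> A}" if "c \<in> Bad" for c
  proof -
    have "card {a \<in> L. (c, a) \<in> A} + card {a \<in> L. (a, c) \<in> A} = card L"
      by (rule tournament_card_out_in[OF T L]) (use that C disj in \<open>auto simp: Bad_def\<close>)
    moreover have "2 * card {a \<in> L. (a, c) \<in> A} < card L + k" using that by (simp add: Bad_def)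
    ultimately show ?thesis using cL by linarith
  qed
  have "card Bad * (card L - k + 1) \<le> (\<Sum>c\<in>Bad. 2 * card {a \<in> L. (c, a) \<in> A})"
    using sum_bounded_below[of Bad "card L - k + 1" "\<lambda>c. 2 * card {a \<in> L. (c, a) \<in> A}"] bad by simp
  also have "\<dots> = 2 * (\<Sum>c\<in>Bad. card {a \<in> L. (c, a) \<in> A})" by (simp add: sum_distrib_left)
  also have "(\<Sum>c\<in>Bad. card {a \<in> L. (c, a) \<in> A}) \<le> (\<Sum>c\<in>C. card {a \<in> L. (c, a) \<in> A})"
    by (rule sum_mono2) (use finC in \<open>auto simp: Bad_def\<close>)
  also have "\<dots> = (\<Sum>a\<in>L. card {c \<in> C. (c, a) \<in> A})" by (rule sum_card_swap[OF finC finL])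
  also have "\<dots> \<le> card L * (k - 1)"
    using sum_bounded_above[of L "\<lambda>a. card {c \<in> C. (c, a) \<in> A}" "k - 1"] low by fastforce
  finally have count: "card Bad * (card L - k + 1) \<le> 2 * (card L * (k - 1))" by simp
  have "card Bad < 4 * k"
  proof (rule ccontr)
    assume "\<not> card Bad < 4 * k"
    then have "4 * k * (card L - k + 1) \<le> card Bad * (card L - k + 1)" by (intro mult_right_mono) auto
    with count have le: "4 * k * (card L - k + 1) \<le> 2 * (card L * (k - 1))" by linarith
    \<comment> \<open>The substitutions remove truncated subtraction: the inequality becomes
      \<open>4 * k * (k + l + 1) \<le> 2 * (2 * k + l) * (k - 1)\<close>, which is absurd.\<close>
    obtain l where l: "card L = 2 * k + l" using cL le_Suc_ex by blast
    obtain j where j: "k = Suc j" using k by (metis One_nat_def Suc_le_D)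
    show False using le unfolding l j by (simp add: algebra_simps)
  qed
  then have "6 * k \<le> card (C - Bad)"
    using card_Diff_subset[OF finB, of C] cC by (simp add: Bad_def)
  moreover have "card {d \<in> C - Bad. (d, a) \<in> A} < k" if "a \<in> L" for a
    by (rule le_less_trans[OF card_mono low[OF that]]) (use finC in auto)
  ultimately show ?thesis
    by (intro invertible_to_strong_if_dominating[OF T k L, of "C - Bad"])
      (use C disj in \<open>auto simp: Bad_def\<close>)
qed

section \<open>Peeling off vertices of low degree\<close>

text \<open>\<open>L\<close> and \<open>H\<close> collect vertices with few in- respectively out-neighbours in the rest \<open>C\<close>, and \<open>U\<close> is
  a reserve of vertices to be inverted once \<open>C\<close> is \<open>k\<close>-strong. Whenever \<open>C \<union> U\<close> fails to be a core, either
  a cut of \<open>C\<close> has two large sides, one dominating the other, or \<open>L\<close> or \<open>H\<close> can be enlarged.\<close>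
definition peeling :: "nat \<Rightarrow> 'a set \<Rightarrow> ('a \<times> 'a) set \<Rightarrow> 'a set \<Rightarrow> 'a set \<Rightarrow> 'a set \<Rightarrow> bool" where
  "peeling k V A L H U \<longleftrightarrow> L \<subseteq> V \<and> H \<subseteq> V \<and> U \<subseteq> V \<and> L \<inter> H = {} \<and> L \<inter> U = {} \<and> H \<inter> U = {} \<and>
     card U = 2 * k - 1 \<and>
     (\<forall>a\<in>L. card {c \<in> V - (L \<union> H \<union> U). (c, a) \<in> A} < k) \<and>
     (\<forall>b\<in>H. card {c \<in> V - (L \<union> H \<union> U). (b, c) \<in> A} < k)"

lemma peeling_converse: "peeling k V (A\<inverse>) L H U \<longleftrightarrow> peeling k V A H L U"
  unfolding peeling_def by (auto simp: Un_commute)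

lemma peeling_card_rest:
  assumes "peeling k V A L H U" "finite V"
  shows "card (V - (L \<union> H \<union> U)) + card L + card H + (2 * k - 1) = card V"
proof -
  have sub: "L \<union> H \<union> U \<subseteq> V" and dis: "L \<inter> H = {}" "(L \<union> H) \<inter> U = {}" and cU: "card U = 2 * k - 1"
    using assms(1) by (auto simp: peeling_def)
  have fin: "finite L" "finite H" "finite U" using sub assms(2) finite_subset by auto
  have "card (L \<union> H \<union> U) = card L + card H + card U"
    using fin dis by (simp add: card_Un_disjoint)
  moreover have "card (V - (L \<union> H \<union> U)) + card (L \<union> H \<union> U) = card V"
    using card_Diff_subset[of "L \<union> H \<union> U" V] card_mono[OF assms(2) sub] fin sub by simp
  ultimately show ?thesis using cU by simp
qed

text \<open>The low-degree conditions refer to a rest that only shrinks, so they survive every step.\<close>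
lemma peeling_extend:
  assumes peel: "peeling k V A L H U" and finV: "finite V"
    and P: "P \<subseteq> V" "P \<inter> (L \<union> H) = {}" and U': "U' \<subseteq> V" "U' \<inter> (L \<union> P \<union> H) = {}" "card U' = 2 * k - 1"
    and UU: "U \<subseteq> P \<union> U'"
    and low: "\<And>a. a \<in> P \<Longrightarrow> card {c \<in> V - (L \<union> P \<union> H \<union> U'). (c, a) \<in> A} < k"
  shows "peeling k V A (L \<union> P) H U'"
proof -
  let ?C = "V - (L \<union> H \<union> U)" and ?C' = "V - (L \<union> P \<union> H \<union> U')"
  have "?C' \<subseteq> ?C" using UU by auto
  then have mono: "card {c \<in> ?C'. Pr c} \<le> card {c \<in> ?C. Pr c}" for Pr
    using finV by (intro card_mono) auto
  have "card {c \<in> ?C'. (c, a) \<in> A} < k" if "a \<in> L" for a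
    using mono peel that unfolding peeling_def by (meson le_less_trans)
  moreover have "card {c \<in> ?C'. (b, c) \<in> A} < k" if "b \<in> H" for b
    using mono peel that unfolding peeling_def by (meson le_less_trans)
  ultimately show ?thesis
    using low peel P U' unfolding peeling_def by auto
qed

text \<open>Induction on how far \<open>L\<close> and \<open>H\<close> are from being full.
  Generalising over \<open>A\<close> allows the reversed tournament with \<open>L\<close> and
  \<open>H\<close> exchanged, so only additions to the first set have to be treated.\<close>

lemma peeling_imp_invertible_to_strong:
  assumes "tournament V A" "k \<ge> 1" "19 * k - 2 \<le> card V"
    and "peeling k V A L H U" "card L < 2 * k" "card H < 2 * k"
  shows "invertible_to_strong k V A"
  using assms
proof (induction "4 * k - (card L + card H)" arbitrary: A L H U rule: less_induct)
  case less
  note T = less.prems(1) and k = less.prems(2) and n = less.prems(3) and peel = less.prems(4)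
    and cL = less.prems(5) and cH = less.prems(6)
  have finV: "finite V" using T by (rule tournament_finite)
  have grow: "invertible_to_strong k V A'"
    if T': "tournament V A'" and peel': "peeling k V A' L' H' U'"
      and c: "card H' < 2 * k" "card L' \<le> 3 * k" "card L + card H < card L' + card H'"
    for A' L' H' U'
  proof (cases "card L' < 2 * k")
    case True
    then show ?thesis using c cL cH by (intro less.hyps[OF _ T' k n peel']) auto
  next
    case False
    show ?thesis
    proof (rule invertible_to_strong_if_many_low[OF T' k, of L' "V - (L' \<union> H' \<union> U')"])
      \<comment> \<open>An added set of at most \<open>k\<close> vertices can carry
        \<open>L'\<close> up to \<open>3 * k\<close>; at least \<open>12 * k\<close> vertices still
        remain.\<close>
      show "10 * k \<le> card (V - (L' \<union> H' \<union> U'))"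
        using peeling_card_rest[OF peel' finV] c n k by linarith
    qed (use False peel' in \<open>auto simp: peeling_def\<close>)
  qed
  have step: "invertible_to_strong k V A'"
    if T': "tournament V A'" and peel': "peeling k V A' L' H' U'"
      and cL': "card L' < 2 * k" and cH': "card H' < 2 * k" and same: "card L' + card H' = card L + card H"
      and P: "P \<noteq> {}" "card P \<le> k" "P \<subseteq> V" "P \<inter> (L' \<union> H') = {}"
      and U'': "U'' \<subseteq> V" "U'' \<inter> (L' \<union> P \<union> H') = {}" "card U'' = 2 * k - 1" "U' \<subseteq> P \<union> U''"
      and low: "\<And>a. a \<in> P \<Longrightarrow> card {c \<in> V - (L' \<union> P \<union> H' \<union> U''). (c, a) \<in> A'} < k"
    for A' L' H' U' P U''
  proof (rule grow[OF T' peeling_extend[OF peel' finV P(3,4) U'' low] cH'])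
    have "finite L'" "finite P"
      using peel' P(3) finV finite_subset unfolding peeling_def by blast+
    moreover have "L' \<inter> P = {}" using P(4) by auto
    ultimately have "card (L' \<union> P) = card L' + card P" "card P > 0"
      using P(1) by (simp_all add: card_Un_disjoint card_gt_0_iff)
    then show "card (L' \<union> P) \<le> 3 * k" "card L + card H < card (L' \<union> P) + card H'"
      using cL' P(2) same by linarith+
  qed
  define C where "C = V - (L \<union> H \<union> U)"
  \<comment> \<open>Each of \<open>L\<close>, \<open>H\<close> and \<open>U\<close> has at most
    \<open>2 * k - 1\<close> vertices, and
    \<open>19 * k - 2 - 3 * (2 * k - 1) = 13 * k + 1\<close>.\<close>
  have cC: "13 * k + 1 \<le> card C"
    using peeling_card_rest[OF peel finV] cL cH n k unfolding C_def by linarith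
  have CV: "C \<subseteq> V" by (auto simp: C_def)
  have finC: "finite C" using CV finV finite_subset by blast
  have UV: "U \<subseteq> V" "U \<inter> (L \<union> H) = {}" "card U = 2 * k - 1"
    using peel by (auto simp: peeling_def)
  have finU: "finite U" using UV finV finite_subset by blast
  have peel': "peeling k V (A\<inverse>) H L U" using peel by (simp add: peeling_converse)
  have T': "tournament V (A\<inverse>)" using T by (rule tournament_converse)
  \<comment> \<open>When \<open>u\<close> leaves the reserve for \<open>L\<close> or
    \<open>H\<close>, a vertex of \<open>C\<close> takes its place.\<close>
  have refill: "\<exists>U'\<subseteq>V. U' \<inter> (L \<union> {u} \<union> H) = {} \<and> card U' = 2 * k - 1 \<and> U \<subseteq> {u} \<union> U' \<and>
      V - (L \<union> {u} \<union> H \<union> U') \<subseteq> C" if u: "u \<in> U" for u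
  proof -
    obtain c where c: "c \<in> C" using cC by fastforce
    show ?thesis
    proof (intro exI[of _ "insert c (U - {u})"] conjI)
      show "card (insert c (U - {u})) = 2 * k - 1"
        using c u UV finU k by (simp add: C_def card_Diff_singleton)
    qed (use c u UV in \<open>auto simp: C_def\<close>)
  qed
  show ?case
  proof (cases "\<exists>u\<in>U. card {c \<in> C. (c, u) \<in> A} < k \<or> card {c \<in> C. (u, c) \<in> A} < k")
    case True
    then obtain u where u: "u \<in> U" "card {c \<in> C. (c, u) \<in> A} < k \<or> card {c \<in> C. (u, c) \<in> A} < k" by blast
    obtain U' where U': "U' \<subseteq> V" "U' \<inter> (L \<union> {u} \<union> H) = {}" "card U' = 2 * k - 1" "U \<subseteq> {u} \<union> U'"
      "V - (L \<union> {u} \<union> H \<union> U') \<subseteq> C"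
      using refill[OF u(1)] by blast
    have less_k: "card {c \<in> V - (L \<union> {u} \<union> H \<union> U'). Pr c} < k" if "card {c \<in> C. Pr c} < k" for Pr
      by (rule le_less_trans[OF card_mono that]) (use finC U'(5) in auto)
    have swap: "L \<union> {u} \<union> H = H \<union> {u} \<union> L" by auto
    have uV: "{u} \<noteq> {}" "card {u} \<le> k" "{u} \<subseteq> V" "{u} \<inter> (L \<union> H) = {}" "{u} \<inter> (H \<union> L) = {}"
      using u UV k by auto
    from u(2) show ?thesis
    proof
      assume "card {c \<in> C. (c, u) \<in> A} < k"
      then show ?thesis
        by (intro step[OF T peel cL cH refl uV(1-4) U'(1-4)]) (use less_k in auto)
    next
      assume "card {c \<in> C. (u, c) \<in> A} < k"
      then have "card {c \<in> V - (H \<union> {u} \<union> L \<union> U'). (u, c) \<in> A} < k"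
        using less_k[of "\<lambda>c. (u, c) \<in> A"] unfolding swap by simp
      then have "invertible_to_strong k V (A\<inverse>)"
        by (intro step[OF T' peel' cH cL add.commute uV(1-3,5) U'(1) U'(2)[unfolded swap] U'(3,4)]) auto
      then show ?thesis by (simp add: invertible_to_strong_converse)
    qed
  next
    case U_ok: False
    show ?thesis
    proof (cases "\<forall>S. finite S \<and> card S < k \<longrightarrow> strongly_connected (C - S) A")
      case True
      \<comment> \<open>Inverting \<open>U\<close> changes no arc inside \<open>C\<close> or between
        \<open>C\<close> and \<open>U\<close>, so each vertex of \<open>U\<close> keeps its
        \<open>k\<close> in- and \<open>k\<close> out-neighbours in \<open>C\<close>.\<close>
      have sc: "strongly_connected (C \<union> U - S) (invert A U)" if S: "finite S" "card S < k" for S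
      proof (rule strongly_connected_extend)
        have "invert A U \<inter> (C - S) \<times> (C - S) = A \<inter> (C - S) \<times> (C - S)"
          by (auto simp: mem_invert_iff C_def split: if_splits)
        then show "strongly_connected (C - S) (invert A U)"
          using True S by (simp add: strongly_connected_def)
        show "C - S \<subseteq> C \<union> U - S" by auto
        fix v assume "v \<in> C \<union> U - S - (C - S)"
        then have v: "v \<in> U" by auto
        have deg: "k \<le> card {c \<in> C. (v, c) \<in> A}" "k \<le> card {c \<in> C. (c, v) \<in> A}"
          using U_ok v by (auto simp: not_less)
        obtain c where "c \<in> C - S" "(v, c) \<in> A" using exists_notin_small[OF S deg(1)] by blast
        moreover obtain d where "d \<in> C - S" "(d, v) \<in> A" using exists_notin_small[OF S deg(2)] by blast
        ultimately show "\<exists>w\<in>C - S. (v, w) \<in> invert A U" "\<exists>w\<in>C - S. (w, v) \<in> invert A U"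
          by (auto simp: mem_invert_iff C_def)
      qed
      have CU: "C \<union> U - U = C" by (auto simp: C_def)
      show ?thesis
        by (rule invertible_to_strong_if_core[OF T k, of "C \<union> U" U])
          (use sc CU UV CV cC in auto)
    next
      case False
      then obtain S where S: "finite S" "card S < k" "\<not> strongly_connected (C - S) A" by blast
      from S(3) obtain P Q where PQ: "P \<noteq> {}" "Q \<noteq> {}" "P \<inter> Q = {}" "P \<union> Q = C - S"
        and no_arc: "\<forall>p\<in>P. \<forall>q\<in>Q. (q, p) \<notin> A"
        by (rule not_strongly_connectedE)
      have no: "(q, p) \<notin> A" if "p \<in> P" "q \<in> Q" for p q using no_arc that by blast
      have sub: "P \<subseteq> V" "Q \<subseteq> V" "P \<subseteq> C" "Q \<subseteq> C" using PQ CV by auto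
      have fin: "finite P" "finite Q" using sub finC finite_subset by blast+
      have yes: "(p, q) \<in> A" if "p \<in> P" "q \<in> Q" for p q
        using no[OF that] tournament_arc_iff[OF T, of p q] that sub PQ(3) by blast
      have size: "12 * k + 2 \<le> card P + card Q"
      proof -
        have "card C - card S \<le> card (C - S)" by (rule diff_card_le_card_Diff[OF S(1)])
        moreover have "card (C - S) = card P + card Q"
          using PQ fin by (metis card_Un_disjoint)
        ultimately show ?thesis using cC S(2) by linarith
      qed
      \<comment> \<open>Once \<open>P\<close> (or \<open>Q\<close>) is peeled off, arcs entering
        \<open>P\<close> from the rest of \<open>C\<close>, or leaving \<open>Q\<close> to it, have
        their other end in the separator \<open>S\<close>.\<close>
      have small: "card {c \<in> Z. Pr c} < k" if "\<And>c. c \<in> Z \<Longrightarrow> Pr c \<Longrightarrow> c \<in> S" for Z Pr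
        by (rule le_less_trans[OF card_mono S(2)]) (use that S in auto)
      \<comment> \<open>A side smaller than \<open>k\<close> is peeled off. Otherwise the larger
        side has over \<open>6 * k\<close> vertices and is dominated by the other, in
        \<open>A\<close> or in its converse; for complete domination the condition
        \<open>dom\<close> just asks for \<open>k\<close> dominating vertices.\<close>
      consider "card P < k" | "card Q < k" | "k \<le> card P" "6 * k \<le> card Q" | "k \<le> card Q" "6 * k \<le> card P"
        using size by linarith
      then show ?thesis
      proof cases
        case 1
        show ?thesis
        proof (rule step[OF T peel cL cH refl PQ(1) _ sub(1) _ UV(1) _ UV(3)])
          fix a assume a: "a \<in> P"
          show "card {c \<in> V - (L \<union> P \<union> H \<union> U). (c, a) \<in> A} < k"
            by (rule small) (use PQ no[OF a] in \<open>auto simp: C_def\<close>)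
        qed (use 1 sub UV in \<open>auto simp: C_def\<close>)
      next
        case 2
        have "invertible_to_strong k V (A\<inverse>)"
        proof (rule step[OF T' peel' cH cL add.commute PQ(2) _ sub(2) _ UV(1) _ UV(3)])
          fix a assume a: "a \<in> Q"
          show "card {c \<in> V - (H \<union> Q \<union> L \<union> U). (c, a) \<in> A\<inverse>} < k"
            by (rule small) (use PQ no[OF _ a] in \<open>auto simp: C_def\<close>)
        qed (use 2 sub UV in \<open>auto simp: C_def\<close>)
        then show ?thesis by (simp add: invertible_to_strong_converse)
      next
        case 3
        show ?thesis
        proof (rule invertible_to_strong_if_dominating[OF T k sub(1,2) PQ(3)])
          fix a assume "a \<in> P"
          then have "{d \<in> Q. (d, a) \<in> A} = {}" using no by auto
          then show "card {d \<in> Q. (d, a) \<in> A} < k" using k by (simp only: card.empty)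
        next
          fix d assume "d \<in> Q"
          then have "{a \<in> P. (a, d) \<in> A} = P" using yes by auto
          then show "card P + k \<le> 2 * card {a \<in> P. (a, d) \<in> A}" using 3 by simp
        qed (use 3 in auto)
      next
        case 4
        have "invertible_to_strong k V (A\<inverse>)"
        proof (rule invertible_to_strong_if_dominating[OF T' k sub(2,1)])
          fix a assume "a \<in> Q"
          then have "{d \<in> P. (d, a) \<in> A\<inverse>} = {}" using no by auto
          then show "card {d \<in> P. (d, a) \<in> A\<inverse>} < k" using k by (simp only: card.empty)
        next
          fix d assume "d \<in> P"
          then have "{a \<in> Q. (a, d) \<in> A\<inverse>} = Q" using yes by auto
          then show "card Q + k \<le> 2 * card {a \<in> Q. (a, d) \<in> A\<inverse>}" using 4 by simp
        qed (use 4 PQ in auto)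
        then show ?thesis by (simp add: invertible_to_strong_converse)
      qed
    qed
  qed
qed

theorem theorem1p10:
  fixes V :: "'a set" and A :: "('a \<times> 'a) set" and n k :: nat
  assumes "n \<ge> 1" and "k \<ge> 1" and "int n \<ge> 19 * int k - 2"
    and "tournament V A" and "card V = n"
  shows "sinv_arc k V A \<le> sinv k V A \<and> sinv k V A \<le> 1"
proof
  have finV: "finite V" using assms(4) by (rule tournament_finite)
  show "sinv_arc k V A \<le> sinv k V A"
    unfolding sinv_arc_def sinv_def
    by (rule INF_superset_mono) (use vertex_strong_imp_arc_strong[OF finV] in auto)
  have n: "19 * k - 2 \<le> card V" using assms(3,5) by linarith
  have "2 * k - 1 \<le> card V" using n assms(2) by linarith
  then obtain U where U: "U \<subseteq> V" "card U = 2 * k - 1" by (rule obtain_subset_with_card_n)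
  \<comment> \<open>Peeling starts with an arbitrary reserve and nothing removed, so the degree
    conditions are vacuous.\<close>
  have "peeling k V A {} {} U" using U by (simp add: peeling_def)
  then have "invertible_to_strong k V A"
    using assms(2) by (intro peeling_imp_invertible_to_strong[OF assms(4,2) n]) auto
  then obtain X where X: "X \<subseteq> V" "vertex_strong k V (invert A X)"
    by (auto simp: invertible_to_strong_def)
  then have "sinv k V A \<le> enat (length [X])"
    unfolding sinv_def by (intro INF_lower) (simp add: invert_seq_def)
  then show "sinv k V A \<le> 1" by (simp add: one_enat_def)
qed

end
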